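(* Let $P=(P,\le)$ be a finite poset and let $\operatorname{DM}(P)$ be its Dedekind–MacNeille completion, with the order embedding $\Gamma:P\hookrightarrow\operatorname{DM}(P)$, $p\mapsto\downarrow p$, by which $P$ is identified with a subset of $\operatorname{DM}(P)$. Then: (i) $\operatorname{c-rk}(P)=\operatorname{c-rk}(\operatorname{DM}(P))=\operatorname{ht}(\operatorname{DM}(P))$. (ii) The c-independent subsets of $P$ are those of $\operatorname{DM}(P)$ restricted to $P$: a subset $W\subseteq P$ is c-independent in $P$ if and only if $W$ (i.e. $\Gamma(W)$) is c-independent in $\operatorname{DM}(P)$.
   Context: The superboolean semiring is $\mathbb{SB}=\{0,1,1^\nu\}$ with commutative operations: $0+x=x$ for all $x$, $1+1=1+1^\nu=1^\nu+1^\nu=1^\nu$; $0\cdot x=0$, $1\cdot x=x$, $1^\nu\cdot 1^\nu=1^\nu$. Vectors $v_1,\dots,v_m\in\mathbb{SB}^{n}$ are dependent if there are $\alpha_1,\dots,\alpha_m\in\{0,1\}$, not all $0$, with $\alpha_1v_1+\cdots+\alpha_mv_m\in\{0,1^\nu\}^{n}$; otherwise they are independent. The rank of a matrix over $\mathbb{SB}$ is the maximal number of independent columns. For a finite poset $(P,\le)$, let $A(P)$ be the matrix with rows and columns indexed by $P$, with entry $a_{p,q}=1$ (row $p$, column $q$) if $p\le q$ and $0$ otherwise, and let $A(P)^{c}$ be its complement (interchange $0$ and $1$), regarded over $\mathbb{SB}$. The c-rank is $\operatorname{c-rk}(P):=\operatorname{rank}(A(P)^{c})$. A subset $W\subseteq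 P$ is c-independent if the columns of $A(P)^{c}$ indexed by $W$ are independent. The height $\operatorname{ht}(P)$ is the largest $k$ such that there is a strict chain $p_0<p_1<\cdots<p_k$ in $P$. For $p\in P$, $\downarrow p=\{x\in P:x\le p\}$. $\operatorname{DM}(P)$ is the set of all intersections of subfamilies of $\{\downarrow p: p\in P\}$, where the empty intersection is $P$ itself, ordered by inclusion; it is a finite lattice with meet given by intersection and top element $P$. *)

theory Defs
  imports Main
begin

section \<open>The superboolean semiring\<close>

datatype sb = SB0 | SB1 | SBnu  \<comment> \<open>\<open>SBnu\<close> is the ghost element \<open>1\<^sup>\<nu>\<close>\<close>

instantiation sb :: comm_semiring_1
begin

definition zero_sb :: sb where "0 = SB0"

definition one_sb :: sb where "1 = SB1"

definition plus_sb :: "sb \<Rightarrow> sb \<Rightarrow> sb" where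
  "x + y = (if x = SB0 then y else if y = SB0 then x else SBnu)"

definition times_sb :: "sb \<Rightarrow> sb \<Rightarrow> sb" where
  "x * y = (if x = SB0 \<or> y = SB0 then SB0 else if x = SB1 then y else if y = SB1 then x else SBnu)"

instance
proof
  fix a b c :: sb
  show "a + b + c = a + (b + c)" by (simp add: plus_sb_def)
  show "a + b = b + a" by (simp add: plus_sb_def)
  show "0 + a = a" by (simp add: plus_sb_def zero_sb_def)
  show "a * b * c = a * (b * c)" by (cases a; cases b; cases c) (simp_all add: times_sb_def)
  show "a * b = b * a" by (cases a; cases b) (simp_all add: times_sb_def)
  show "1 * a = a" by (simp add: times_sb_def one_sb_def)
  show "(a + b) * c = a * c + b * c"
    by (cases a; cases b; cases c) (simp_all add: times_sb_def plus_sb_def)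
  show "0 * a = 0" by (simp add: times_sb_def zero_sb_def)
  show "a * 0 = 0" by (simp add: times_sb_def zero_sb_def)
  show "(0::sb) \<noteq> 1" by (simp add: zero_sb_def one_sb_def)
qed

end


section \<open>Dependence and rank over the superboolean semiring\<close>

text \<open>A family \<open>v\<close> indexed by a finite set \<open>J\<close>, of vectors with coordinates in \<open>I\<close>; the \<open>i\<close>-th
  coordinate of the \<open>j\<close>-th vector is \<open>v j i\<close>. Vectors are counted with repetition, so two equal
  vectors at different indices are dependent.\<close>

definition sb_dependent :: "'i set \<Rightarrow> 'j set \<Rightarrow> ('j \<Rightarrow> 'i \<Rightarrow> sb) \<Rightarrow> bool" where
  "sb_dependent I J v \<longleftrightarrow>
     (\<exists>\<alpha>. (\<forall>j\<in>J. \<alpha> j \<in> {0, 1}) \<and> (\<exists>j\<in>J. \<alpha> j \<noteq> 0) \<and>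
          (\<forall>i\<in>I. (\<Sum>j\<in>J. \<alpha> j * v j i) \<in> {0, SBnu}))"

abbreviation sb_independent :: "'i set \<Rightarrow> 'j set \<Rightarrow> ('j \<Rightarrow> 'i \<Rightarrow> sb) \<Rightarrow> bool" where
  "sb_independent I J v \<equiv> \<not> sb_dependent I J v"

text \<open>A matrix \<open>M\<close> has rows indexed by \<open>I\<close> and columns indexed by \<open>J\<close>, with entries \<open>M i j\<close>.\<close>

definition column :: "('i \<Rightarrow> 'j \<Rightarrow> sb) \<Rightarrow> 'j \<Rightarrow> 'i \<Rightarrow> sb" where
  "column M j = (\<lambda>i. M i j)"

definition sb_rank :: "'i set \<Rightarrow> 'j set \<Rightarrow> ('i \<Rightarrow> 'j \<Rightarrow> sb) \<Rightarrow> nat" where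
  "sb_rank I J M = Max {card W | W. W \<subseteq> J \<and> sb_independent I W (column M)}"


section \<open>The c-rank and the height of a finite poset\<close>

text \<open>A poset is a carrier \<open>P\<close> together with a relation \<open>r\<close> such that \<open>partial_order_on P r\<close>;
  \<open>p \<le> q\<close> is \<open>(p, q) \<in> r\<close>.\<close>

definition order_matrix :: "'a rel \<Rightarrow> 'a \<Rightarrow> 'a \<Rightarrow> sb" where
  "order_matrix r p q = (if (p, q) \<in> r then 1 else 0)"

definition compl_matrix :: "('i \<Rightarrow> 'j \<Rightarrow> sb) \<Rightarrow> 'i \<Rightarrow> 'j \<Rightarrow> sb" where
  "compl_matrix M i j = (if M i j = 0 then 1 else if M i j = 1 then 0 else M i j)"

definition c_rank :: "'a set \<Rightarrow> 'a rel \<Rightarrow> nat" where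
  "c_rank P r = sb_rank P P (compl_matrix (order_matrix r))"

definition c_independent :: "'a set \<Rightarrow> 'a rel \<Rightarrow> 'a set \<Rightarrow> bool" where
  "c_independent P r W \<longleftrightarrow> sb_independent P W (column (compl_matrix (order_matrix r)))"

text \<open>The height is only meaningful for a nonempty finite poset (the maximum of the empty set is
  unspecified); this is always the case for a Dedekind--MacNeille completion of a finite poset.\<close>

definition height :: "'a set \<Rightarrow> 'a rel \<Rightarrow> nat" where
  "height P r = Max {k. \<exists>p :: nat \<Rightarrow> 'a. (\<forall>i\<le>k. p i \<in> P) \<and>
                          (\<forall>i<k. (p i, p (Suc i)) \<in> r \<and> p i \<noteq> p (Suc i))}"


section \<open>The Dedekind--MacNeille completion\<close>

definition down :: "'a set \<Rightarrow> 'a rel \<Rightarrow> 'a \<Rightarrow> 'a set" where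
  "down P r p = {x \<in> P. (x, p) \<in> r}"

text \<open>Intersecting with \<open>P\<close> only matters for the empty subfamily, where it makes the empty
  intersection equal to \<open>P\<close>.\<close>

definition DM :: "'a set \<Rightarrow> 'a rel \<Rightarrow> 'a set set" where
  "DM P r = {P \<inter> \<Inter>F | F. F \<subseteq> down P r ` P}"

definition DM_order :: "'a set \<Rightarrow> 'a rel \<Rightarrow> 'a set rel" where
  "DM_order P r = {(X, Y). X \<in> DM P r \<and> Y \<in> DM P r \<and> X \<subseteq> Y}"

lemma finite_DM: "finite P \<Longrightarrow> finite (DM P r)"
  by (rule finite_subset[of _ "Pow P"]) (auto simp: DM_def)

lemma top_in_DM: "P \<in> DM P r"
  by (auto simp: DM_def intro: exI[of _ "{}"])

lemma partial_order_on_DM: "partial_order_on (DM P r) (DM_order P r)"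
  by (auto simp: partial_order_on_def preorder_on_def refl_on_def trans_def antisym_def DM_order_def)

lemma DM_inter:
  assumes "X \<in> DM P r" "Y \<in> DM P r"
  shows "X \<inter> Y \<in> DM P r"
proof -
  from assms obtain F G where "X = P \<inter> \<Inter>F" "F \<subseteq> down P r ` P" "Y = P \<inter> \<Inter>G" "G \<subseteq> down P r ` P"
    unfolding DM_def by blast
  then have "X \<inter> Y = P \<inter> \<Inter>(F \<union> G)" "F \<union> G \<subseteq> down P r ` P" by auto
  then show ?thesis unfolding DM_def by blast
qed

lemma down_in_DM: "p \<in> P \<Longrightarrow> down P r p \<in> DM P r"
  unfolding DM_def by (rule CollectI, rule exI[of _ "{down P r p}"]) (auto simp: down_def)

lemma down_embedding:
  assumes "partial_order_on P r" "p \<in> P" "q \<in> P"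
  shows "(down P r p, down P r q) \<in> DM_order P r \<longleftrightarrow> (p, q) \<in> r"
proof -
  have r: "(p, p) \<in> r" and t: "trans r"
    using assms by (auto simp: partial_order_on_def preorder_on_def refl_on_def)
  have "down P r p \<subseteq> down P r q \<longleftrightarrow> (p, q) \<in> r"
    using r t assms(2) by (auto simp: down_def dest: transD)
  then show ?thesis
    using assms by (simp add: DM_order_def down_in_DM)
qed

lemma inj_on_down:
  assumes "partial_order_on P r"
  shows "inj_on (down P r) P"
proof (rule inj_onI)
  fix p q
  assume pq: "p \<in> P" "q \<in> P" and eq: "down P r p = down P r q"
  have "(down P r p, down P r q) \<in> DM_order P r" "(down P r q, down P r p) \<in> DM_order P r"
    using pq eq down_in_DM[of p P r] by (simp_all add: DM_order_def)
  then have "(p, q) \<in> r" "(q, p) \<in> r"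
    using down_embedding[OF assms] pq by simp_all
  moreover have "antisym r" using assms by (simp add: partial_order_on_def)
  ultimately show "p = q" by (simp add: antisymD)
qed

end

theory Submission
  imports Defs
begin

text \<open>
  Over the superboolean semiring a sum of zeros and ones avoids \<open>{0, 1\<^sup>\<nu>}\<close> exactly when it has a
  single term \<open>1\<close>. Hence \<open>W\<close> is c-independent iff every nonempty \<open>X \<subseteq> W\<close> has a member \<open>q\<close> that
  some \<open>p\<close> separates from the rest of \<open>X\<close>: \<open>p\<close> lies below every other member of \<open>X\<close> but not below
  \<open>q\<close> (\<open>c_independent_iff_separated\<close>). In other words, \<open>\<down>q\<close> does not contain the intersection of the
  remaining principal ideals, and this is a statement about \<open>DM P r\<close> as much as about \<open>P\<close>: a
  separating \<open>p\<close> gives the separating cut (member of \<open>DM P r\<close>) \<open>\<down>p\<close>, and a separating cut contains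
  a separating element. This is part (ii).

  For part (i), the numbers that occur as cardinalities of c-independent subsets of \<open>P\<close>, as
  cardinalities of c-independent subsets of \<open>DM P r\<close>, and as lengths of strict chains of
  \<open>DM P r\<close> form the same set, so their maxima agree. Three inclusions close a cycle.
  From \<open>P\<close> to \<open>DM P r\<close>, use (ii). From a c-independent set of cuts, discard separated members one
  at a time; the intersection of the remaining ones grows strictly at each step until it
  reaches \<open>P\<close> (\<open>c_independent_DM_imp_chain\<close>). From a chain \<open>X\<^sub>0 \<subset> \<dots> \<subset> X\<^sub>k\<close>, choose
  \<open>p\<^sub>i \<in> X\<^sub>i\<^sub>+\<^sub>1 - X\<^sub>i\<close> and, as \<open>X\<^sub>i\<close> is an intersection of principal ideals, an element \<open>w\<^sub>i\<close> of \<open>P\<close> with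
  \<open>X\<^sub>i \<subseteq> \<down>w\<^sub>i\<close> and \<open>p\<^sub>i \<notin> \<down>w\<^sub>i\<close>. Then \<open>p\<^sub>i \<le> w\<^sub>j\<close> for all \<open>j > i\<close>, so the matrix with rows \<open>p\<^sub>i\<close> and columns
  \<open>w\<^sub>j\<close> is triangular, which makes the \<open>w\<^sub>i\<close> distinct and c-independent
  (\<open>chain_imp_c_independent\<close>).
\<close>

section \<open>Independence as separation\<close>

lemma of_nat_sb: "(of_nat n :: sb) = (if n = 0 then SB0 else if n = 1 then SB1 else SBnu)"
  by (induction n) (auto simp: plus_sb_def zero_sb_def one_sb_def)

lemma compl_order_matrix: "compl_matrix (order_matrix r) p q = of_bool ((p, q) \<notin> r)"
  by (simp add: compl_matrix_def order_matrix_def)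

lemma sum_of_bool_sb:
  assumes "finite J"
  shows "(\<Sum>j\<in>J. of_bool (B j) :: sb) \<in> {0, SBnu} \<longleftrightarrow> \<not> (\<exists>!j. j \<in> J \<and> B j)"
proof -
  have "(\<exists>!j. j \<in> J \<and> B j) \<longleftrightarrow> card (J \<inter> {j. B j}) = 1"
    by (auto simp: card_1_singleton_iff Ex1_def)
  then show ?thesis
    using assms by (auto simp: of_nat_sb zero_sb_def)
qed

definition separated :: "'a set \<Rightarrow> 'a rel \<Rightarrow> 'a set \<Rightarrow> 'a \<Rightarrow> bool" where
  "separated P r X q \<longleftrightarrow> (\<exists>p\<in>P. (p, q) \<notin> r \<and> (\<forall>x\<in>X - {q}. (p, x) \<in> r))"

text \<open>A choice of coefficients in \<open>{0, 1}\<close> is a subset \<open>X\<close> of \<open>W\<close>, and row \<open>p\<close> obstructs dependence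
  iff exactly one member of \<open>X\<close> is not above \<open>p\<close>.\<close>

lemma c_independent_iff_separated:
  assumes "finite W"
  shows "c_independent P r W \<longleftrightarrow> (\<forall>X\<subseteq>W. X \<noteq> {} \<longrightarrow> (\<exists>q\<in>X. separated P r X q))"
proof -
  let ?zero = "\<lambda>\<alpha> i. (\<Sum>j\<in>W. \<alpha> j * column (compl_matrix (order_matrix r)) j i) \<in> {0, SBnu}"
  have row: "?zero \<alpha> i \<longleftrightarrow> \<not> (\<exists>!j. j \<in> W \<and> \<alpha> j \<noteq> 0 \<and> (i, j) \<notin> r)"
    if "\<forall>j\<in>W. \<alpha> j \<in> {0, 1}" for \<alpha> i
  proof -
    have "(\<Sum>j\<in>W. \<alpha> j * column (compl_matrix (order_matrix r)) j i)
        = (\<Sum>j\<in>W. of_bool (\<alpha> j \<noteq> 0 \<and> (i, j) \<notin> r))"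
      using that by (intro sum.cong) (auto simp: column_def compl_order_matrix)
    then show ?thesis
      using sum_of_bool_sb[OF assms, of "\<lambda>j. \<alpha> j \<noteq> 0 \<and> (i, j) \<notin> r"] by simp
  qed
  have sep: "(\<exists>q\<in>X. separated P r X q) \<longleftrightarrow> (\<exists>i\<in>P. \<exists>!j. j \<in> X \<and> (i, j) \<notin> r)" for X
    by (auto simp: separated_def Ex1_def)
  show ?thesis
  proof
    assume indep: "c_independent P r W"
    show "\<forall>X\<subseteq>W. X \<noteq> {} \<longrightarrow> (\<exists>q\<in>X. separated P r X q)"
    proof (intro allI impI)
      fix X assume X: "X \<subseteq> W" "X \<noteq> {}"
      let ?\<alpha> = "\<lambda>j. of_bool (j \<in> X) :: sb"
      have \<alpha>: "\<forall>j\<in>W. ?\<alpha> j \<in> {0, 1}" and "\<exists>j\<in>W. ?\<alpha> j \<noteq> 0"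
        using X by auto
      have "\<not> (\<forall>i\<in>P. ?zero ?\<alpha> i)"
      proof
        assume "\<forall>i\<in>P. ?zero ?\<alpha> i"
        then have "sb_dependent P W (column (compl_matrix (order_matrix r)))"
          unfolding sb_dependent_def using \<alpha> \<open>\<exists>j\<in>W. ?\<alpha> j \<noteq> 0\<close>
          by (intro exI[of _ ?\<alpha>] conjI)
        with indep show False
          by (simp add: c_independent_def)
      qed
      then obtain i where "i \<in> P" "\<not> ?zero ?\<alpha> i"
        by blast
      then have "\<exists>!j. j \<in> W \<and> ?\<alpha> j \<noteq> 0 \<and> (i, j) \<notin> r"
        using row[OF \<alpha>] by blast
      moreover have "j \<in> W \<and> ?\<alpha> j \<noteq> 0 \<and> (i, j) \<notin> r \<longleftrightarrow> j \<in> X \<and> (i, j) \<notin> r" for j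
        using X by auto
      ultimately have "\<exists>!j. j \<in> X \<and> (i, j) \<notin> r"
        by simp
      with \<open>i \<in> P\<close> show "\<exists>q\<in>X. separated P r X q"
        unfolding sep by blast
    qed
  next
    assume all: "\<forall>X\<subseteq>W. X \<noteq> {} \<longrightarrow> (\<exists>q\<in>X. separated P r X q)"
    show "c_independent P r W"
      unfolding c_independent_def sb_dependent_def
    proof (intro notI, elim exE conjE)
      fix \<alpha>
      assume \<alpha>: "\<forall>j\<in>W. \<alpha> j \<in> {0, 1}" "\<exists>j\<in>W. \<alpha> j \<noteq> 0" and zero: "\<forall>i\<in>P. ?zero \<alpha> i"
      let ?X = "{j \<in> W. \<alpha> j \<noteq> 0}"
      have "\<exists>q\<in>?X. separated P r ?X q"
        using all[rule_format, of ?X] \<alpha>(2) by blast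
      then obtain i where "i \<in> P" "\<exists>!j. j \<in> W \<and> \<alpha> j \<noteq> 0 \<and> (i, j) \<notin> r"
        unfolding sep by auto
      then show False
        using row[OF \<alpha>(1)] zero by blast
    qed
  qed
qed

lemma c_independent_subset:
  assumes "finite W" "c_independent P r W" "V \<subseteq> W"
  shows "c_independent P r V"
  using assms by (auto simp: c_independent_iff_separated finite_subset)

section \<open>Independence in the completion\<close>

text \<open>The embedding transports separation because \<open>\<down>p\<close> is a cut, and because a cut \<open>Z\<close> with
  \<open>Z \<subseteq> \<down>x\<close> for all other \<open>x\<close> and \<open>\<not> Z \<subseteq> \<down>q\<close> has an element outside \<open>\<down>q\<close>, which separates \<open>q\<close>.\<close>

lemma separated_down_iff:
  assumes "partial_order_on P r" "X \<subseteq> P" "q \<in> X"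
  shows "separated (DM P r) (DM_order P r) (down P r ` X) (down P r q) \<longleftrightarrow> separated P r X q"
proof
  have inj: "down P r ` X - {down P r q} = down P r ` (X - {q})"
    using inj_on_down[OF assms(1)] assms(2,3) by (auto simp: inj_on_def)
  {
    assume "separated P r X q"
    then obtain p where p: "p \<in> P" "(p, q) \<notin> r" "\<forall>x\<in>X - {q}. (p, x) \<in> r"
      unfolding separated_def by blast
    have "(down P r p, down P r x) \<in> DM_order P r \<longleftrightarrow> (p, x) \<in> r" if "x \<in> X" for x
      using down_embedding[OF assms(1) p(1)] that assms(2) by blast
    then show "separated (DM P r) (DM_order P r) (down P r ` X) (down P r q)"
      using p assms(3) unfolding separated_def inj
      by (intro bexI[of _ "down P r p"]) (auto simp: down_in_DM)
  }
  {
    assume "separated (DM P r) (DM_order P r) (down P r ` X) (down P r q)"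
    then obtain Z where Z: "Z \<in> DM P r" "(Z, down P r q) \<notin> DM_order P r"
      "\<forall>x\<in>X - {q}. (Z, down P r x) \<in> DM_order P r"
      unfolding separated_def inj by blast
    have "\<not> Z \<subseteq> down P r q"
      using Z assms(2,3) by (auto simp: DM_order_def down_in_DM)
    then obtain p where p: "p \<in> Z" "p \<notin> down P r q"
      by blast
    moreover have "p \<in> P"
      using Z(1) p(1) by (auto simp: DM_def)
    ultimately show "separated P r X q"
      using Z(3) unfolding separated_def
      by (intro bexI[of _ p]) (auto simp: DM_order_def down_def)
  }
qed

lemma c_independent_down_iff:
  assumes "finite P" "partial_order_on P r" "W \<subseteq> P"
  shows "c_independent (DM P r) (DM_order P r) (down P r ` W) \<longleftrightarrow> c_independent P r W"
proof -
  have "(\<exists>q\<in>X. separated (DM P r) (DM_order P r) (down P r ` X) (down P r q))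
      \<longleftrightarrow> (\<exists>q\<in>X. separated P r X q)" if "X \<subseteq> W" for X
    using separated_down_iff[OF assms(2)] that assms(3) by (meson subset_trans)
  then show ?thesis
    using finite_subset[OF assms(3,1)]
    by (simp add: c_independent_iff_separated all_subset_image)
qed

section \<open>Independent sets and chains\<close>

definition strict_chain :: "'a set \<Rightarrow> 'a rel \<Rightarrow> nat \<Rightarrow> (nat \<Rightarrow> 'a) \<Rightarrow> bool" where
  "strict_chain P r k c \<longleftrightarrow>
     (\<forall>i\<le>k. c i \<in> P) \<and> (\<forall>i<k. (c i, c (Suc i)) \<in> r \<and> c i \<noteq> c (Suc i))"

text \<open>Fixing the start of the chain at \<open>P \<inter> \<Inter>W\<close> lets the induction prepend one cut per discarded
  member of \<open>W\<close>. The intersection grows strictly because the separating cut lies in the new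
  intersection but not in the discarded member.\<close>

lemma c_independent_DM_imp_chain:
  assumes "finite W" "W \<subseteq> DM P r" "c_independent (DM P r) (DM_order P r) W"
  shows "\<exists>c. c 0 = P \<inter> \<Inter>W \<and> strict_chain (DM P r) (DM_order P r) (card W) c"
  using assms
proof (induction "card W" arbitrary: W)
  case 0
  then have "W = {}"
    by simp
  then show ?case
    by (intro exI[of _ "\<lambda>_. P"]) (simp add: strict_chain_def top_in_DM)
next
  case (Suc k)
  have "W \<noteq> {}"
    using Suc.hyps(2) by auto
  then obtain q Z where q: "q \<in> W" and Z: "Z \<in> DM P r" "(Z, q) \<notin> DM_order P r"
    "\<forall>x\<in>W - {q}. (Z, x) \<in> DM_order P r"
    using Suc.prems(3) unfolding c_independent_iff_separated[OF Suc.prems(1)] separated_def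
    by (meson subset_refl)
  let ?V = "W - {q}"
  have V: "k = card ?V" "finite ?V" "?V \<subseteq> DM P r" "c_independent (DM P r) (DM_order P r) ?V"
    using Suc.hyps(2) Suc.prems(1,2) q c_independent_subset[OF Suc.prems(1,3), of ?V] by auto
  then obtain c where c0: "c 0 = P \<inter> \<Inter>?V" and c: "strict_chain (DM P r) (DM_order P r) k c"
    using Suc.hyps(1)[OF V] V(1) by auto
  have c0_DM: "c 0 \<in> DM P r"
    using c by (simp add: strict_chain_def)
  have split: "P \<inter> \<Inter>W = q \<inter> c 0"
    using q by (auto simp: c0)
  have Z_P: "Z \<subseteq> P"
    using Z(1) unfolding DM_def by blast
  have "Z \<subseteq> c 0" "\<not> Z \<subseteq> q"
    using Z Z_P q Suc.prems(2) by (auto simp: c0 DM_order_def)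
  then have "P \<inter> \<Inter>W \<noteq> c 0"
    unfolding split by blast
  moreover have "P \<inter> \<Inter>W \<in> DM P r"
    unfolding split using q Suc.prems(2) c0_DM by (intro DM_inter) auto
  ultimately have "strict_chain (DM P r) (DM_order P r) (Suc k) (case_nat (P \<inter> \<Inter>W) c)"
    using c c0_DM by (auto simp: strict_chain_def DM_order_def split split: nat.split)
  then show ?case
    unfolding Suc.hyps(2)[symmetric] by (intro exI[of _ "case_nat (P \<inter> \<Inter>W) c"]) simp
qed

text \<open>Within any nonempty selection of the \<open>w\<^sub>i\<close>, triangularity separates the one of least
  index.\<close>

lemma triangular_imp_c_independent:
  fixes k :: nat
  assumes "\<And>i. i < k \<Longrightarrow> p i \<in> P"
    and diag: "\<And>i. i < k \<Longrightarrow> (p i, w i) \<notin> r"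
    and upper: "\<And>i j. i < j \<Longrightarrow> j < k \<Longrightarrow> (p i, w j) \<in> r"
  shows "inj_on w {..<k}" "c_independent P r (w ` {..<k})"
proof -
  show "inj_on w {..<k}"
  proof (rule linorder_inj_onI)
    fix i j assume "i < j" "i \<in> {..<k}" "j \<in> {..<k}"
    then show "w i \<noteq> w j"
      using diag[of i] upper[of i j] by auto
  qed auto
  show "c_independent P r (w ` {..<k})"
    unfolding c_independent_iff_separated[OF finite_imageI[OF finite_lessThan]]
  proof (intro allI impI)
    fix X assume X: "X \<subseteq> w ` {..<k}" "X \<noteq> {}"
    define m where "m = (LEAST i. i < k \<and> w i \<in> X)"
    have "\<exists>i. i < k \<and> w i \<in> X"
      using X by blast
    then have m: "m < k" "w m \<in> X"
      unfolding m_def by (auto intro: LeastI2_ex)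
    have "(p m, x) \<in> r" if "x \<in> X - {w m}" for x
    proof -
      have "x \<in> w ` {..<k}"
        using X(1) that by blast
      then obtain j where j: "j < k" "x = w j"
        by blast
      have "m \<le> j"
        unfolding m_def using j that by (intro Least_le) auto
      then have "m < j"
        using j that by (cases "m = j") auto
      then show ?thesis
        using upper j by blast
    qed
    then show "\<exists>q\<in>X. separated P r X q"
      using m assms(1) diag unfolding separated_def by blast
  qed
qed

lemma DM_separating_element:
  assumes "X \<in> DM P r" "p \<in> P" "p \<notin> X"
  obtains w where "w \<in> P" "X \<subseteq> down P r w" "(p, w) \<notin> r"
proof -
  obtain F where F: "X = P \<inter> \<Inter>F" "F \<subseteq> down P r ` P"
    using assms(1) unfolding DM_def by blast
  with assms(2,3) obtain w where "w \<in> P" "down P r w \<in> F" "p \<notin> down P r w"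
    by blast
  with F assms(2) show thesis
    by (intro that[of w]) (auto simp: down_def)
qed

lemma chain_imp_c_independent:
  assumes "strict_chain (DM P r) (DM_order P r) k X"
  shows "\<exists>W\<subseteq>P. card W = k \<and> c_independent P r W"
proof -
  have DM: "X i \<in> DM P r" if "i \<le> k" for i
    using assms that by (simp add: strict_chain_def)
  have step: "X i \<subset> X (Suc i)" if "i < k" for i
    using assms that by (auto simp: strict_chain_def DM_order_def)
  have mono: "X i \<subseteq> X j" if "i \<le> j" "j \<le> k" for i j
    using that
  proof (induction j rule: dec_induct)
    case (step n)
    then show ?case
      using \<open>\<And>i. i < k \<Longrightarrow> X i \<subset> X (Suc i)\<close>[of n] by auto
  qed simp
  have sub: "X i \<subseteq> P" if "i \<le> k" for i
    using DM[OF that] by (auto simp: DM_def)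
  have "\<exists>p w. p \<in> X (Suc i) \<and> w \<in> P \<and> X i \<subseteq> down P r w \<and> (p, w) \<notin> r" if i: "i < k" for i
  proof -
    obtain p where p: "p \<in> X (Suc i)" "p \<notin> X i"
      using step[OF i] by blast
    moreover have "p \<in> P"
      using p(1) sub[of "Suc i"] i by auto
    ultimately show ?thesis
      using DM_separating_element[of "X i" P r p] DM[of i] i by (metis less_imp_le)
  qed
  then obtain p w where pw: "\<And>i. i < k \<Longrightarrow>
      p i \<in> X (Suc i) \<and> w i \<in> P \<and> X i \<subseteq> down P r (w i) \<and> (p i, w i) \<notin> r"
    by metis
  have "p i \<in> P" if "i < k" for i
    using pw[OF that] sub[of "Suc i"] that by auto
  moreover have "(p i, w j) \<in> r" if "i < j" "j < k" for i j
  proof -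
    have "p i \<in> X j"
      using pw[of i] mono[of "Suc i" j] that by auto
    then show ?thesis
      using pw[of j] that by (auto simp: down_def)
  qed
  ultimately have "inj_on w {..<k}" "c_independent P r (w ` {..<k})"
    using triangular_imp_c_independent[of k p P w r] pw by blast+
  then show ?thesis
    using pw by (intro exI[of _ "w ` {..<k}"]) (auto simp: card_image)
qed

theorem theorem4p12:
  fixes P :: "'a set" and r :: "'a rel"
  assumes "finite P" and "partial_order_on P r"
  shows "c_rank P r = c_rank (DM P r) (DM_order P r)
       \<and> c_rank (DM P r) (DM_order P r) = height (DM P r) (DM_order P r)
       \<and> (\<forall>W \<subseteq> P. c_independent P r W \<longleftrightarrow>
             c_independent (DM P r) (DM_order P r) (down P r ` W))"
proof -
  let ?D = "DM P r" and ?R = "DM_order P r"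
  let ?SP = "{card W | W. W \<subseteq> P \<and> c_independent P r W}"
  let ?SD = "{card W | W. W \<subseteq> ?D \<and> c_independent ?D ?R W}"
  let ?C = "{k. \<exists>c. strict_chain ?D ?R k c}"
  have "?SP \<subseteq> ?SD"
  proof clarify
    fix W assume W: "W \<subseteq> P" "c_independent P r W"
    have "card (down P r ` W) = card W"
      using inj_on_down[OF assms(2)] W(1) by (meson card_image inj_on_subset)
    moreover have "down P r ` W \<subseteq> ?D"
      using W(1) by (auto simp: down_in_DM)
    ultimately show "\<exists>V. card W = card V \<and> V \<subseteq> ?D \<and> c_independent ?D ?R V"
      using c_independent_down_iff[OF assms W(1)] W(2) by metis
  qed
  moreover have "?SD \<subseteq> ?C"
  proof clarify
    fix W assume W: "W \<subseteq> ?D" "c_independent ?D ?R W"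
    then show "\<exists>c. strict_chain ?D ?R (card W) c"
      using c_independent_DM_imp_chain[OF finite_subset[OF W(1) finite_DM[OF assms(1)]] W] by blast
  qed
  moreover have "?C \<subseteq> ?SP"
  proof clarify
    fix k X assume "strict_chain ?D ?R k X"
    from chain_imp_c_independent[OF this]
    show "\<exists>W. k = card W \<and> W \<subseteq> P \<and> c_independent P r W"
      by blast
  qed
  ultimately have "?SP = ?SD" "?SD = ?C"
    by (meson subset_antisym subset_trans)+
  moreover have "c_rank P r = Max ?SP" "c_rank ?D ?R = Max ?SD" "height ?D ?R = Max ?C"
    by (simp_all add: c_rank_def sb_rank_def c_independent_def height_def strict_chain_def)
  ultimately show ?thesis
    using c_independent_down_iff[OF assms] by simp
qed

end
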